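(* Let $q\geq 2$ be an integer. The map $d\colon(\mathbb{R}^q)^3\to\mathbb{R}$ that carries $(x_1,x_2,x_3)$ into the total length of a minimal spanning tree of $\mathcal{G}(x_1,x_2,x_3)$ is a $3$-distance on $\mathbb{R}^q$. Its best constant is $K^*_3=1/\sqrt{3}$, and it is attained at any $(x_1,x_2,x_3;z)$ such that $x_1,x_2,x_3$ are the vertices of an equilateral triangle with centroid $z$.
   Context: $\mathbb{R}_+=[0,+\infty[$. For points $x_1,\ldots,x_n\in\mathbb{R}^q$, $\mathcal{G}(x_1,\ldots,x_n)$ denotes the complete Euclidean graph whose vertex set is the set $\{x_1,\ldots,x_n\}$, i.e., the complete graph on this set in which each edge has length equal to the Euclidean distance between its endpoints. A minimal spanning tree is a spanning tree of least total edge length (this length is $0$ if the vertex set is a singleton). For a set $X$ with at least two elements, a $3$-distance on $X$ is a map $d\colon X^3\to\mathbb{R}_+$ such that: (i) $d(x_1,x_2,x_3)=0$ if and only if $x_1=x_2=x_3$; (ii) $d$ is invariant under any permutation of its arguments; (iii) $d(x_1,x_2,x_3)\leq\sum_{i=1}^3 d(x_1,x_2,x_3)_i^z$ for all $x_1,x_2,x_3,z\in X$, where $d(x_1,x_2,x_3)_i^z$ denotes the value obtained from $d(x_1,x_2,x_3)$ by replacing its $i$th argument by $z$. The best constant associated with a $3$-distance $d$ on $X$ is $$K^*_3=\sup\left\{\frac{d(x_1,x_2,x_3)}{\sum_{i=1}^3 d(x_1,x_2,x_3)_i^z}: x_1,x_2,x_3,z\in X,\ |\{x_1,x_2,x_3\}|\geq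 2\right\}.$$ It is attained at $(x_1,x_2,x_3;z)$ if the ratio at this tuple equals $K^*_3$. *)

theory Defs
  imports "HOL-Analysis.Analysis"
begin

text \<open>
  An undirected simple graph is given by a vertex set \<open>V\<close> and a set \<open>E\<close> of two-element
  subsets of \<open>V\<close>. The predicate \<open>spanning_tree\<close> of the AFP entry Graph Theory is not used: it
  excludes directed cycles only, so it also accepts the orientation \<open>a \<rightarrow> b\<close>, \<open>b \<rightarrow> c\<close>, \<open>a \<rightarrow> c\<close> of
  a triangle.
\<close>

definition complete_edges :: "'a set \<Rightarrow> 'a set set" where
  "complete_edges V = {{u, v} | u v. u \<in> V \<and> v \<in> V \<and> u \<noteq> v}"

definition graph_connected :: "'a set \<Rightarrow> 'a set set \<Rightarrow> bool" where
  "graph_connected V E \<longleftrightarrow> (\<forall>u\<in>V. \<forall>v\<in>V. (u, v) \<in> {(a, b). {a, b} \<in> E}\<^sup>*)"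

text \<open>A cycle is given by the list of its pairwise distinct vertices in cyclic order.\<close>

definition graph_cycle :: "'a set set \<Rightarrow> 'a list \<Rightarrow> bool" where
  "graph_cycle E vs \<longleftrightarrow> 3 \<le> length vs \<and> distinct vs \<and>
     (\<forall>i<length vs. {vs ! i, vs ! (Suc i mod length vs)} \<in> E)"

definition spanning_tree :: "'a set \<Rightarrow> 'a set set \<Rightarrow> 'a set set \<Rightarrow> bool" where
  "spanning_tree V E T \<longleftrightarrow> T \<subseteq> E \<and> graph_connected V T \<and> (\<nexists>vs. graph_cycle T vs)"

definition minimal_spanning_tree ::
    "('a set \<Rightarrow> real) \<Rightarrow> 'a set \<Rightarrow> 'a set set \<Rightarrow> 'a set set \<Rightarrow> bool" where
  "minimal_spanning_tree w V E T \<longleftrightarrow> spanning_tree V E T \<and>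
     (\<forall>T'. spanning_tree V E T' \<longrightarrow> sum w T \<le> sum w T')"

definition edge_length :: "'a::metric_space set \<Rightarrow> real" where
  "edge_length e = (THE l. \<exists>x y. e = {x, y} \<and> l = dist x y)"

lemma edge_length_doubleton: "edge_length {x, y} = dist x y"
  unfolding edge_length_def
  by (rule the_equality) (auto simp: doubleton_eq_iff dist_commute)

text \<open>
  The total length of a minimal spanning tree of the complete Euclidean graph on \<open>V\<close>. The choice
  of the tree is immaterial, by lemma \<open>mst_length_eq\<close>.
\<close>

definition mst_length :: "'a::metric_space set \<Rightarrow> real" where
  "mst_length V =
     sum edge_length (SOME T. minimal_spanning_tree edge_length V (complete_edges V) T)"

lemma mst_length_eq:
  assumes "minimal_spanning_tree edge_length V (complete_edges V) T"
  shows "mst_length V = sum edge_length T"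
proof -
  let ?M = "minimal_spanning_tree edge_length V (complete_edges V)"
  have "?M (SOME T. ?M T)"
    using assms by (rule someI)
  with assms show ?thesis
    unfolding mst_length_def minimal_spanning_tree_def by (meson order_antisym)
qed

definition mst_dist :: "'a::metric_space \<Rightarrow> 'a \<Rightarrow> 'a \<Rightarrow> real" where
  "mst_dist x1 x2 x3 = mst_length {x1, x2, x3}"

definition replacement_sum :: "('a \<Rightarrow> 'a \<Rightarrow> 'a \<Rightarrow> real) \<Rightarrow> 'a \<Rightarrow> 'a \<Rightarrow> 'a \<Rightarrow> 'a \<Rightarrow> real" where
  "replacement_sum d x1 x2 x3 z = d z x2 x3 + d x1 z x3 + d x1 x2 z"

definition three_distance :: "'a set \<Rightarrow> ('a \<Rightarrow> 'a \<Rightarrow> 'a \<Rightarrow> real) \<Rightarrow> bool" where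
  "three_distance X d \<longleftrightarrow>
     (\<exists>x\<in>X. \<exists>y\<in>X. x \<noteq> y) \<and>
     (\<forall>x1\<in>X. \<forall>x2\<in>X. \<forall>x3\<in>X. 0 \<le> d x1 x2 x3) \<and>
     (\<forall>x1\<in>X. \<forall>x2\<in>X. \<forall>x3\<in>X. d x1 x2 x3 = 0 \<longleftrightarrow> x1 = x2 \<and> x2 = x3) \<and>
     (\<forall>x1\<in>X. \<forall>x2\<in>X. \<forall>x3\<in>X.
        d x1 x3 x2 = d x1 x2 x3 \<and> d x2 x1 x3 = d x1 x2 x3 \<and> d x2 x3 x1 = d x1 x2 x3 \<and>
        d x3 x1 x2 = d x1 x2 x3 \<and> d x3 x2 x1 = d x1 x2 x3) \<and>
     (\<forall>x1\<in>X. \<forall>x2\<in>X. \<forall>x3\<in>X. \<forall>z\<in>X. d x1 x2 x3 \<le> replacement_sum d x1 x2 x3 z)"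

text \<open>
  If \<open>d\<close> is a 3-distance on \<open>X\<close>, then the set below is nonempty and bounded above by \<open>1\<close>, and all
  denominators are positive; so the real supremum and the division are the intended ones.
\<close>

definition best_constant3 :: "'a set \<Rightarrow> ('a \<Rightarrow> 'a \<Rightarrow> 'a \<Rightarrow> real) \<Rightarrow> real" where
  "best_constant3 X d =
     Sup {d x1 x2 x3 / replacement_sum d x1 x2 x3 z | x1 x2 x3 z.
       x1 \<in> X \<and> x2 \<in> X \<and> x3 \<in> X \<and> z \<in> X \<and> 2 \<le> card {x1, x2, x3}}"

definition best_constant3_attained_at ::
    "'a set \<Rightarrow> ('a \<Rightarrow> 'a \<Rightarrow> 'a \<Rightarrow> real) \<Rightarrow> 'a \<Rightarrow> 'a \<Rightarrow> 'a \<Rightarrow> 'a \<Rightarrow> bool" where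
  "best_constant3_attained_at X d x1 x2 x3 z \<longleftrightarrow>
     x1 \<in> X \<and> x2 \<in> X \<and> x3 \<in> X \<and> z \<in> X \<and> 2 \<le> card {x1, x2, x3} \<and>
     d x1 x2 x3 / replacement_sum d x1 x2 x3 z = best_constant3 X d"

definition equilateral_triangle :: "'a::metric_space \<Rightarrow> 'a \<Rightarrow> 'a \<Rightarrow> bool" where
  "equilateral_triangle x1 x2 x3 \<longleftrightarrow>
     x1 \<noteq> x2 \<and> dist x1 x2 = dist x2 x3 \<and> dist x2 x3 = dist x3 x1"

definition triangle_centroid :: "'a::real_vector \<Rightarrow> 'a \<Rightarrow> 'a \<Rightarrow> 'a" where
  "triangle_centroid x1 x2 x3 = (1 / 3) *\<^sub>R (x1 + x2 + x3)"

end

theory Submission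
  imports Defs
begin

text \<open>
  Three points with mutual distances \<open>a, b, c\<close> have a minimal spanning tree of length
  \<open>a + b + c - max a b c\<close>, the sum of the two shortest sides (\<open>mst_dist_eq_min\<close>); this remains
  true when points coincide.  So the whole proposition reduces to the inequality
  \<open>sqrt 3 * d x1 x2 x3 \<le> replacement_sum d x1 x2 x3 z\<close>, with equality for an equilateral triangle
  and its centroid: since \<open>1 \<le> sqrt 3\<close>, the simplex inequality follows from it as well.

  Replacing a vertex \<open>xi\<close> by \<open>z\<close> gives a triangle with apex \<open>z\<close>.  If in all three of these
  triangles the minimal spanning tree consists of the two edges at \<open>z\<close>, the replacement sum is
  twice the length of the star from \<open>z\<close> to \<open>x1, x2, x3\<close>, and the claim is the fact that the Steiner
  ratio of three points is \<open>sqrt 3 / 2\<close> (\<open>star_length_ge\<close>).  If in some of them the tree uses a side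
  of the original triangle, the triangle inequality alone gives the stronger constant \<open>2\<close>
  (\<open>replacement_sum_dichotomy\<close>).

  The Steiner ratio bound is proved by duality.  Put the vertex where the two shortest sides \<open>A\<close>
  and \<open>B\<close> meet at the origin; the angle there is at least 60 degrees.  For vectors \<open>e\<close> and \<open>f\<close>
  such that \<open>e\<close>, \<open>f\<close> and \<open>e + f\<close> have norm at most \<open>1\<close>, the star from any \<open>z\<close> has length at least
  \<open>A \<bullet> e + B \<bullet> f\<close>.  If \<open>e\<close> and \<open>f\<close> are taken 120 degrees apart, symmetrically about the bisector
  of the angle, each of them deviates by at most 30 degrees from its side, so that the bound is at
  least \<open>cos 30 = sqrt 3 / 2\<close> times \<open>norm A + norm B\<close>.
\<close>

section \<open>Minimal spanning trees on three points\<close>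

text \<open>The first three edges of a cycle are already pairwise distinct.\<close>

lemma graph_cycle_card_ge_3:
  assumes "graph_cycle E vs" "finite E"
  shows "3 \<le> card E"
proof -
  define n where "n = length vs"
  define w where "w = vs ! (3 mod n)"
  have n: "3 \<le> n" and d: "distinct vs"
    and e: "\<And>i. i < n \<Longrightarrow> {vs ! i, vs ! (Suc i mod n)} \<in> E"
    using assms(1) unfolding graph_cycle_def n_def by auto
  have inj: "vs ! i = vs ! j \<longleftrightarrow> i = j" if "i < n" "j < n" for i j
    using nth_eq_iff_index_eq[OF d] that n_def by blast
  have edges: "{vs ! 0, vs ! 1} \<in> E" "{vs ! 1, vs ! 2} \<in> E" "{vs ! 2, w} \<in> E"
    using e[of 0] e[of 1] e[of 2] n unfolding w_def by (simp_all add: numeral_2_eq_2 numeral_3_eq_3)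
  have vertices: "vs ! 0 \<noteq> vs ! 1" "vs ! 1 \<noteq> vs ! 2" "vs ! 0 \<noteq> vs ! 2"
    using inj[of 0 1] inj[of 1 2] inj[of 0 2] n by simp_all
  have "3 mod n \<noteq> 1"
    using n by (cases "n = 3") simp_all
  then have "w \<noteq> vs ! 1"
    using inj[of "3 mod n" 1] n unfolding w_def by simp
  then have "card {{vs ! 0, vs ! 1}, {vs ! 1, vs ! 2}, {vs ! 2, w}} = 3"
    using vertices by (simp add: doubleton_eq_iff)
  moreover have "{{vs ! 0, vs ! 1}, {vs ! 1, vs ! 2}, {vs ! 2, w}} \<subseteq> E"
    using edges by simp
  ultimately show ?thesis
    using card_mono[OF assms(2)] by metis
qed

lemma graph_connected_crossing_edge:
  assumes "graph_connected V E" "u \<in> V" "v \<in> V" "u \<in> A" "v \<notin> A"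
  obtains a b where "a \<in> A" "b \<notin> A" "{a, b} \<in> E"
proof -
  have "(u, v) \<in> {(a, b). {a, b} \<in> E}\<^sup>*"
    using assms unfolding graph_connected_def by blast
  then have "v \<notin> A \<longrightarrow> (\<exists>a\<in>A. \<exists>b. b \<notin> A \<and> {a, b} \<in> E)"
    by (induction rule: rtrancl_induct) (use assms(4) in auto)
  then show ?thesis
    using that assms(5) by blast
qed

lemma edge_length_nonneg: "e \<in> complete_edges V \<Longrightarrow> 0 \<le> edge_length e"
  by (auto simp: complete_edges_def edge_length_doubleton)

lemma finite_complete_edges: "finite V \<Longrightarrow> finite (complete_edges V)"
  by (rule finite_subset[of _ "Pow V"]) (auto simp: complete_edges_def)

text \<open>
  Every spanning tree has an edge leaving each vertex, hence contains two of the three sides; it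
  costs least to omit the longest side, which is the one opposite to \<open>y\<close>.
  Intersecting with \<open>complete_edges\<close> removes the loops that arise when points coincide.
\<close>

lemma minimal_spanning_tree_path:
  fixes x y z :: "'a::metric_space"
  assumes "dist x y \<le> dist x z" "dist y z \<le> dist x z"
  defines "V \<equiv> {x, y, z}"
  defines "T \<equiv> {{x, y}, {y, z}} \<inter> complete_edges V"
  shows "minimal_spanning_tree edge_length V (complete_edges V) T"
    and "sum edge_length T = dist x y + dist y z"
proof -
  have *: "{u, v} \<in> complete_edges V \<longleftrightarrow> u \<in> V \<and> v \<in> V \<and> u \<noteq> v" for u v
    by (auto simp: complete_edges_def doubleton_eq_iff)
  have xz: "x = y \<and> y = z" if "x = z"
    using that assms(1) by auto
  have V: "x \<in> V" "y \<in> V" "z \<in> V"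
    by (simp_all add: V_def)
  have no_loop: "{u} \<notin> complete_edges V" for u
    using *[of u u] by simp
  have T: "T = (if x = y then {} else {{x, y}}) \<union> (if y = z then {} else {{y, z}})"
    unfolding T_def using V * no_loop by auto
  show sumT: "sum edge_length T = dist x y + dist y z"
  proof (cases "x = y \<or> y = z")
    case True
    then show ?thesis
      by (auto simp: T edge_length_doubleton)
  next
    case False
    then have "{x, y} \<noteq> {y, z}"
      using xz by (auto simp: doubleton_eq_iff)
    then show ?thesis
      using False by (simp add: T edge_length_doubleton)
  qed
  have finT: "finite T"
    unfolding T_def by simp
  have "card T \<le> card {{x, y}, {y, z}}"
    unfolding T_def by (rule card_mono) auto
  also have "\<dots> \<le> 2"
    by (simp add: card_insert_if)
  finally have cyc: "\<not> graph_cycle T vs" for vs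
    using graph_cycle_card_ge_3[OF _ finT] by fastforce
  have conn: "graph_connected V T"
  proof -
    let ?R = "{(a, b). {a, b} \<in> T}"
    have edge: "(u, v) \<in> ?R\<^sup>*" if "u = v \<or> {u, v} \<in> T" for u v
      using that by auto
    have "(x, y) \<in> ?R\<^sup>*" "(y, x) \<in> ?R\<^sup>*" "(y, z) \<in> ?R\<^sup>*" "(z, y) \<in> ?R\<^sup>*"
      by (rule edge; simp add: T insert_commute)+
    \<comment> \<open>Any two vertices are joined by way of \<open>y\<close>.\<close>
    then have "(u, y) \<in> ?R\<^sup>*" "(y, u) \<in> ?R\<^sup>*" if "u \<in> V" for u
      using that unfolding V_def by auto
    then show ?thesis
      unfolding graph_connected_def by (blast intro: rtrancl_trans)
  qed
  have "dist x y + dist y z \<le> sum edge_length S" if S: "spanning_tree V (complete_edges V) S" for S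
  proof -
    have sub: "S \<subseteq> complete_edges V" and con: "graph_connected V S"
      using S by (auto simp: spanning_tree_def)
    have fin: "finite S"
      using sub finite_complete_edges[of V] finite_subset by (auto simp: V_def)
    have ge: "sum edge_length S' \<le> sum edge_length S" if "S' \<subseteq> S" for S'
      using that fin sub edge_length_nonneg by (intro sum_mono2) auto
    have cross: "\<exists>v. v \<in> V \<and> v \<noteq> u \<and> {u, v} \<in> S"
      if uw: "u \<in> V" "w \<in> V" "w \<noteq> u" for u w
    proof -
      obtain b where "b \<noteq> u" "{u, b} \<in> S"
        using graph_connected_crossing_edge[OF con uw(1,2), of "{u}"] uw(3)
        by (metis insertI1 singletonD)
      then show ?thesis
        using sub * by blast
    qed
    consider "x = y" "y = z" | "x = y" "y \<noteq> z" | "x \<noteq> y" "y = z" | "x \<noteq> y" "y \<noteq> z" "x \<noteq> z"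
      using xz by blast
    then show ?thesis
    proof cases
      case 1
      then show ?thesis
        using ge[of "{}"] by simp
    next
      case 2
      then have "{y, z} \<in> S"
        using cross[of y z] by (auto simp: V_def)
      then show ?thesis
        using ge[of "{{y, z}}"] 2 by (simp add: edge_length_doubleton)
    next
      case 3
      then have "{x, y} \<in> S"
        using cross[of x y] by (auto simp: V_def)
      then show ?thesis
        using ge[of "{{x, y}}"] 3 by (simp add: edge_length_doubleton)
    next
      case 4
      have "{x, y} \<in> S \<or> {x, z} \<in> S" "{x, y} \<in> S \<or> {y, z} \<in> S" "{x, z} \<in> S \<or> {y, z} \<in> S"
        using cross[of x y] cross[of y x] cross[of z x] 4 by (auto simp: V_def insert_commute)
      then consider "{{x, y}, {y, z}} \<subseteq> S" | "{{x, y}, {x, z}} \<subseteq> S" | "{{x, z}, {y, z}} \<subseteq> S"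
        by auto
      then show ?thesis
      proof cases
        case a: 1
        then show ?thesis
          using ge[OF a] 4 by (simp add: edge_length_doubleton doubleton_eq_iff)
      next
        case a: 2
        then show ?thesis
          using ge[OF a] 4 assms(2) by (simp add: edge_length_doubleton doubleton_eq_iff)
      next
        case a: 3
        then show ?thesis
          using ge[OF a] 4 assms(1) by (simp add: edge_length_doubleton doubleton_eq_iff)
      qed
    qed
  qed
  then show "minimal_spanning_tree edge_length V (complete_edges V) T"
    using cyc conn sumT unfolding minimal_spanning_tree_def spanning_tree_def T_def by auto
qed

lemma mst_dist_path:
  assumes "dist x y \<le> dist x z" "dist y z \<le> dist x z"
  shows "mst_dist x y z = dist x y + dist y z"
  unfolding mst_dist_def
  using mst_length_eq minimal_spanning_tree_path[OF assms] by metis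

lemma mst_dist_swap: "mst_dist x z y = mst_dist x y z" "mst_dist y x z = mst_dist x y z"
  by (simp_all add: mst_dist_def insert_commute)

lemma mst_dist_eq_min:
  "mst_dist x y z = min (dist x y + dist y z) (min (dist y z + dist x z) (dist x z + dist x y))"
proof -
  have "dist y x = dist x y" "dist z y = dist y z"
    by (simp_all add: dist_commute)
  then have
    "dist x y \<le> dist x z \<Longrightarrow> dist y z \<le> dist x z \<Longrightarrow> mst_dist x y z = dist x y + dist y z"
    "dist x y \<le> dist y z \<Longrightarrow> dist x z \<le> dist y z \<Longrightarrow> mst_dist x y z = dist x z + dist x y"
    "dist x z \<le> dist x y \<Longrightarrow> dist y z \<le> dist x y \<Longrightarrow> mst_dist x y z = dist y z + dist x z"
    using mst_dist_path[of x y z] mst_dist_path[of y x z] mst_dist_path[of x z y]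
    by (simp_all add: mst_dist_swap)
  then show ?thesis
    by (auto simp: min_def not_le)
qed

lemma mst_dist_nonneg: "0 \<le> mst_dist x y z"
  by (simp add: mst_dist_eq_min)

lemma mst_dist_eq_0_iff: "mst_dist x y z = 0 \<longleftrightarrow> x = y \<and> y = z"
proof
  assume "mst_dist x y z = 0"
  then have "dist x y = 0 \<and> dist y z = 0"
    using zero_le_dist[of x y] zero_le_dist[of y z] zero_le_dist[of x z]
      dist_triangle[of x z y] dist_triangle[of x y z] dist_triangle[of y z x]
    unfolding mst_dist_eq_min min_def by (simp add: dist_commute split: if_splits)
  then show "x = y \<and> y = z"
    by simp
qed (simp add: mst_dist_eq_min)

section \<open>The Steiner ratio of three points\<close>

text \<open>Weak duality for the Fermat point problem with terminals \<open>0\<close>, \<open>A\<close>, \<open>B\<close>.\<close>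

lemma star_length_dual_bound:
  fixes A B z e f :: "'a::real_inner"
  assumes "norm e \<le> 1" "norm f \<le> 1" "norm (e + f) \<le> 1"
  shows "A \<bullet> e + B \<bullet> f \<le> norm z + norm (z - A) + norm (z - B)"
proof -
  have le: "v \<bullet> g \<le> norm v" if "norm g \<le> 1" for v g :: 'a
    using norm_cauchy_schwarz[of v g] mult_left_mono[OF that norm_ge_zero[of v]] by simp
  have "A \<bullet> e + B \<bullet> f = (A - z) \<bullet> e + (B - z) \<bullet> f + z \<bullet> (e + f)"
    by (simp add: inner_diff_left inner_add_right)
  also have "\<dots> \<le> norm (A - z) + norm (B - z) + norm z"
    using assms by (intro add_mono le)
  finally show ?thesis
    by (simp add: norm_minus_commute)
qed

text \<open>
  The dual certificate: \<open>e\<close> and \<open>f\<close> make angles of 60 degrees with the bisector \<open>\<alpha> + \<beta>\<close> of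
  \<open>\<alpha>\<close> and \<open>\<beta>\<close>.  If \<open>2 \<theta> \<ge> 60\<close> degrees is the angle between \<open>\<alpha>\<close> and \<open>\<beta>\<close>, then
  \<open>\<alpha> \<bullet> e = \<beta> \<bullet> f = cos (60 - \<theta>)\<close> in degrees, which is at least \<open>cos 30\<close>.  When \<open>\<beta> = -\<alpha>\<close> the
  bisector is undefined; then \<open>sgn 0 = 0\<close> only shortens \<open>e\<close> and \<open>f\<close>.
\<close>

lemma dual_certificate:
  fixes \<alpha> \<beta> :: "'a::real_inner"
  assumes "norm \<alpha> = 1" "norm \<beta> = 1" "\<alpha> \<bullet> \<beta> \<le> 1 / 2"
  obtains e f where "norm e \<le> 1" "norm f \<le> 1" "norm (e + f) \<le> 1"
    "sqrt 3 / 2 \<le> \<alpha> \<bullet> e" "sqrt 3 / 2 \<le> \<beta> \<bullet> f"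
proof -
  define s t where "s = sgn (\<alpha> + \<beta>)" and "t = sgn (\<alpha> - \<beta>)"
  define S D where "S = norm (\<alpha> + \<beta>)" and "D = norm (\<alpha> - \<beta>)"
  define e f where "e = (1 / 2) *\<^sub>R s + (sqrt 3 / 2) *\<^sub>R t"
    and "f = (1 / 2) *\<^sub>R s - (sqrt 3 / 2) *\<^sub>R t"
  have unit: "\<alpha> \<bullet> \<alpha> = 1" "\<beta> \<bullet> \<beta> = 1"
    using assms(1,2) by (simp_all add: dot_square_norm)
  have S2: "S\<^sup>2 = 2 + 2 * (\<alpha> \<bullet> \<beta>)" and D2: "D\<^sup>2 = 2 - 2 * (\<alpha> \<bullet> \<beta>)"
    using unit unfolding S_def D_def power2_norm_eq_inner
    by (simp_all add: inner_add_left inner_add_right inner_diff_left inner_diff_right inner_commute)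
  have pos: "0 \<le> S" "0 \<le> D"
    by (simp_all add: S_def D_def)
  have "1\<^sup>2 \<le> D\<^sup>2"
    using D2 assms(3) by simp
  then have D1: "1 \<le> D"
    using pos(2) by (rule power2_le_imp_le)
  have "D\<^sup>2 \<le> 2\<^sup>2"
    using S2 D2 zero_le_power2[of S] by simp
  then have D_le: "D \<le> 2"
    by (rule power2_le_imp_le) simp
  \<comment> \<open>On the circle \<open>S\<^sup>2 + D\<^sup>2 = 4\<close>, the chord from \<open>(0, 2)\<close> to the point with \<open>D = 1\<close>, where the
    angle is 60 degrees, lies below the arc.\<close>
  have key: "sqrt 3 * (2 - D) \<le> S"
  proof (rule power2_le_imp_le[OF _ pos(1)])
    have "S\<^sup>2 - (sqrt 3 * (2 - D))\<^sup>2 = 4 * (2 - D) * (D - 1)"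
      using S2 D2 by (simp add: power_mult_distrib power2_eq_square algebra_simps)
    also have "\<dots> \<ge> 0"
      using D1 D_le by simp
    finally show "(sqrt 3 * (2 - D))\<^sup>2 \<le> S\<^sup>2"
      by simp
  qed
  have ss: "s \<bullet> s \<le> 1" and tt: "t \<bullet> t \<le> 1"
    by (simp_all add: s_def t_def dot_square_norm norm_sgn)
  have orth: "(\<alpha> + \<beta>) \<bullet> (\<alpha> - \<beta>) = 0"
    using unit by (simp add: inner_add_left inner_diff_right inner_commute[of \<beta> \<alpha>])
  then have st: "s \<bullet> t = 0"
    by (simp only: s_def t_def sgn_div_norm inner_scaleR_left inner_scaleR_right)
  have st': "t \<bullet> s = 0"
    using st by (simp add: inner_commute)
  have "e \<bullet> e = s \<bullet> s / 4 + 3 / 4 * (t \<bullet> t)" "f \<bullet> f = s \<bullet> s / 4 + 3 / 4 * (t \<bullet> t)"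
    unfolding e_def f_def
    by (simp_all add: inner_add_left inner_add_right inner_diff_left inner_diff_right st st')
  then have ef: "norm e \<le> 1" "norm f \<le> 1"
    using ss tt by (simp_all add: norm_eq_sqrt_inner)
  have "e + f = s"
    by (simp add: e_def f_def flip: scaleR_2)
  then have sum: "norm (e + f) \<le> 1"
    using ss by (simp add: norm_eq_sqrt_inner)
  have inner_sgn: "v \<bullet> sgn v = norm v" for v :: 'a
    by (cases "v = 0") (simp_all add: sgn_div_norm dot_square_norm power2_eq_square)
  have orth': "(\<alpha> - \<beta>) \<bullet> (\<alpha> + \<beta>) = 0"
    using orth by (simp only: inner_commute)
  have "(\<alpha> + \<beta>) \<bullet> s = S" "(\<alpha> - \<beta>) \<bullet> t = D"
    by (simp_all only: s_def t_def S_def D_def inner_sgn)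
  moreover have "(\<alpha> + \<beta>) \<bullet> t = 0" "(\<alpha> - \<beta>) \<bullet> s = 0"
    using orth orth' by (simp_all only: s_def t_def sgn_div_norm inner_scaleR_right mult_zero_right)
  ultimately have coords: "\<alpha> \<bullet> s = S / 2" "\<beta> \<bullet> s = S / 2" "\<alpha> \<bullet> t = D / 2" "\<beta> \<bullet> t = - D / 2"
    by (simp_all add: inner_add_left inner_diff_left)
  then have "\<alpha> \<bullet> e = (S + sqrt 3 * D) / 4" "\<beta> \<bullet> f = (S + sqrt 3 * D) / 4"
    by (simp_all only: e_def f_def inner_add_right inner_diff_right inner_scaleR_right coords)
       (simp_all add: field_simps)
  moreover have "2 * sqrt 3 \<le> S + sqrt 3 * D"
    using key by (simp add: algebra_simps)
  ultimately show ?thesis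
    using that[OF ef sum] by simp
qed

lemma sqrt_3_bounds: "1 \<le> sqrt 3" "sqrt 3 \<le> 2"
  by (simp_all add: real_le_lsqrt)

lemma star_length_ge_origin:
  fixes A B z :: "'a::real_inner"
  assumes "norm A \<le> norm (A - B)" "norm B \<le> norm (A - B)"
  shows "sqrt 3 / 2 * (norm A + norm B) \<le> norm z + norm (z - A) + norm (z - B)"
proof (cases "A = 0 \<or> B = 0")
  case True
  have "sqrt 3 / 2 * (norm A + norm B) \<le> norm A + norm B"
    using mult_right_mono[of "sqrt 3 / 2" 1 "norm A + norm B"] sqrt_3_bounds(2) by simp
  moreover have "norm A \<le> norm z + norm (z - A)" "norm B \<le> norm z + norm (z - B)"
    by norm+
  ultimately show ?thesis
    using True norm_ge_zero[of "z - A"] norm_ge_zero[of "z - B"]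
    by (auto simp del: norm_ge_zero)
next
  case False
  define \<alpha> \<beta> where "\<alpha> = sgn A" and "\<beta> = sgn B"
  have AB: "A = norm A *\<^sub>R \<alpha>" "B = norm B *\<^sub>R \<beta>"
    using False by (simp_all add: \<alpha>_def \<beta>_def sgn_div_norm)
  have "(norm (A - B))\<^sup>2 = (norm A)\<^sup>2 + (norm B)\<^sup>2 - 2 * (A \<bullet> B)"
    by (simp add: power2_norm_eq_inner inner_diff_left inner_diff_right inner_commute)
  then have "2 * (A \<bullet> B) \<le> (norm A)\<^sup>2" "2 * (A \<bullet> B) \<le> (norm B)\<^sup>2"
    using power_mono[OF assms(1), of 2] power_mono[OF assms(2), of 2] by simp_all
  \<comment> \<open>The angle at the origin is at least 60 degrees, because the side opposite to it is longest.\<close>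
  then have "2 * (A \<bullet> B) \<le> norm A * norm B"
    using mult_left_mono[of "norm A" "norm B" "norm A"] mult_left_mono[of "norm B" "norm A" "norm B"]
    by (cases "norm A \<le> norm B") (simp_all add: power2_eq_square mult.commute)
  then have "\<alpha> \<bullet> \<beta> \<le> 1 / 2"
    using False by (simp add: \<alpha>_def \<beta>_def sgn_div_norm field_simps)
  moreover have "norm \<alpha> = 1" "norm \<beta> = 1"
    using False by (simp_all add: \<alpha>_def \<beta>_def norm_sgn)
  ultimately obtain e f where ef: "norm e \<le> 1" "norm f \<le> 1" "norm (e + f) \<le> 1"
    and ge: "sqrt 3 / 2 \<le> \<alpha> \<bullet> e" "sqrt 3 / 2 \<le> \<beta> \<bullet> f"
    using dual_certificate by metis
  have "A \<bullet> e = norm A * (\<alpha> \<bullet> e)" "B \<bullet> f = norm B * (\<beta> \<bullet> f)"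
    by (subst AB, simp)+
  then have "sqrt 3 / 2 * (norm A + norm B) \<le> A \<bullet> e + B \<bullet> f"
    using mult_left_mono[OF ge(1), of "norm A"] mult_left_mono[OF ge(2), of "norm B"]
    by (simp add: algebra_simps)
  also have "\<dots> \<le> norm z + norm (z - A) + norm (z - B)"
    by (rule star_length_dual_bound[OF ef])
  finally show ?thesis .
qed

lemma star_length_ge_path:
  fixes x y v z :: "'a::real_inner"
  assumes "dist x v \<le> dist x y" "dist y v \<le> dist x y"
  shows "sqrt 3 / 2 * (dist x v + dist y v) \<le> dist z x + dist z y + dist z v"
  using star_length_ge_origin[of "x - v" "y - v" "z - v"] assms by (simp add: dist_norm)

lemma star_length_ge:
  fixes x1 x2 x3 z :: "'a::real_inner"
  shows "sqrt 3 / 2 * mst_dist x1 x2 x3 \<le> dist z x1 + dist z x2 + dist z x3"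
proof -
  consider "dist x1 x2 \<le> dist x1 x3" "dist x2 x3 \<le> dist x1 x3"
    | "dist x1 x2 \<le> dist x2 x3" "dist x1 x3 \<le> dist x2 x3"
    | "dist x1 x3 \<le> dist x1 x2" "dist x2 x3 \<le> dist x1 x2"
    by linarith
  then show ?thesis
  proof cases
    case 1
    then show ?thesis
      using star_length_ge_path[of x1 x2 x3 z] mst_dist_path[of x1 x2 x3]
      by (simp add: dist_commute)
  next
    case 2
    then show ?thesis
      using star_length_ge_path[of x2 x1 x3 z] mst_dist_path[of x2 x1 x3]
      by (simp add: dist_commute mst_dist_swap)
  next
    case 3
    then show ?thesis
      using star_length_ge_path[of x1 x3 x2 z] mst_dist_path[of x1 x3 x2]
      by (simp add: dist_commute mst_dist_swap)
  qed
qed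

section \<open>The sharp simplex inequality\<close>

text \<open>
  The minimal spanning tree either joins the apex \<open>z\<close> to both ends of the side, or exchanges the
  longer one of these two edges for the side.
\<close>

lemma mst_dist_apex_cases:
  "mst_dist z x y = dist z x + dist z y \<or>
   mst_dist z x y = dist z x + dist x y \<and> dist x y \<le> dist z y \<or>
   mst_dist z x y = dist z y + dist x y \<and> dist x y \<le> dist z x"
  unfolding mst_dist_eq_min min_def by auto

text \<open>
  As soon as one side occurs, its upper bound by an edge at \<open>z\<close> makes it possible to pair up the
  remaining edges at \<open>z\<close> so that, by the triangle inequality, two spanning paths of the original
  triangle are covered.
\<close>

lemma replacement_sum_dichotomy:
  "replacement_sum mst_dist x1 x2 x3 z = 2 * (dist z x1 + dist z x2 + dist z x3) \<or>
    2 * mst_dist x1 x2 x3 \<le> replacement_sum mst_dist x1 x2 x3 z"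
proof -
  have tri: "dist x1 x2 \<le> dist z x1 + dist z x2" "dist x1 x3 \<le> dist z x1 + dist z x3"
    "dist x2 x3 \<le> dist z x2 + dist z x3"
    by (fact dist_triangle3)+
  have le: "mst_dist x1 x2 x3 \<le> dist x1 x2 + dist x2 x3"
    "mst_dist x1 x2 x3 \<le> dist x2 x3 + dist x1 x3"
    "mst_dist x1 x2 x3 \<le> dist x1 x3 + dist x1 x2"
    by (simp_all add: mst_dist_eq_min)
  have sum: "replacement_sum mst_dist x1 x2 x3 z =
      mst_dist z x2 x3 + mst_dist z x1 x3 + mst_dist z x1 x2"
    unfolding replacement_sum_def mst_dist_def by (simp add: insert_commute)
  show ?thesis
  proof (cases "mst_dist z x2 x3 = dist z x2 + dist z x3 \<and>
      mst_dist z x1 x3 = dist z x1 + dist z x3 \<and> mst_dist z x1 x2 = dist z x1 + dist z x2")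
    case True
    then show ?thesis
      by (simp add: sum)
  next
    case False
    have "2 * mst_dist x1 x2 x3 \<le> mst_dist z x2 x3 + mst_dist z x1 x3 + mst_dist z x1 x2"
      using mst_dist_apex_cases[of z x2 x3] mst_dist_apex_cases[of z x1 x3]
        mst_dist_apex_cases[of z x1 x2] False tri le
        zero_le_dist[of z x1] zero_le_dist[of z x2] zero_le_dist[of z x3]
      \<comment> \<open>The first of the 27 combinations is the star, which the case assumption excludes.\<close>
      by (elim disjE conjE) (blast, linarith+)
    then show ?thesis
      by (simp add: sum)
  qed
qed

lemma sqrt3_mst_dist_le_replacement_sum:
  fixes x1 x2 x3 z :: "'a::real_inner"
  shows "sqrt 3 * mst_dist x1 x2 x3 \<le> replacement_sum mst_dist x1 x2 x3 z"
proof -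
  have "sqrt 3 * mst_dist x1 x2 x3 \<le> 2 * mst_dist x1 x2 x3"
    by (rule mult_right_mono[OF sqrt_3_bounds(2) mst_dist_nonneg])
  then show ?thesis
    using replacement_sum_dichotomy[of x1 x2 x3 z] star_length_ge[of x1 x2 x3 z] by auto
qed

lemma three_distance_mst_dist:
  assumes "\<exists>x y :: 'a::real_inner. x \<noteq> y"
  shows "three_distance UNIV (mst_dist :: 'a \<Rightarrow> 'a \<Rightarrow> 'a \<Rightarrow> real)"
proof -
  have "mst_dist x1 x2 x3 \<le> replacement_sum mst_dist x1 x2 x3 z" for x1 x2 x3 z :: 'a
    using mult_right_mono[OF sqrt_3_bounds(1) mst_dist_nonneg[of x1 x2 x3]]
      sqrt3_mst_dist_le_replacement_sum[of x1 x2 x3 z] by simp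
  moreover have "mst_dist x1 x3 x2 = mst_dist x1 x2 x3 \<and> mst_dist x2 x1 x3 = mst_dist x1 x2 x3 \<and>
      mst_dist x2 x3 x1 = mst_dist x1 x2 x3 \<and> mst_dist x3 x1 x2 = mst_dist x1 x2 x3 \<and>
      mst_dist x3 x2 x1 = mst_dist x1 x2 x3" for x1 x2 x3 :: 'a
    by (simp add: mst_dist_def insert_commute)
  ultimately show ?thesis
    using assms unfolding three_distance_def
    by (intro conjI ballI) (simp_all add: mst_dist_nonneg mst_dist_eq_0_iff)
qed

section \<open>Equality for equilateral triangles\<close>

lemma dist_triangle_centroid:
  fixes x1 x2 x3 :: "'a::real_inner"
  assumes "dist x1 x2 = s" "dist x2 x3 = s" "dist x3 x1 = s"
  shows "dist (triangle_centroid x1 x2 x3) x1 = s / sqrt 3"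
proof -
  define u v where "u = x2 - x1" and "v = x3 - x1"
  have s: "0 \<le> s"
    using assms(1) by auto
  have "norm u = s" "norm v = s" "norm (u - v) = s"
    using assms by (simp_all add: u_def v_def dist_norm norm_minus_commute)
  then have n: "u \<bullet> u = s\<^sup>2" "v \<bullet> v = s\<^sup>2" "(u - v) \<bullet> (u - v) = s\<^sup>2"
    by (simp_all add: dot_square_norm)
  then have "2 * (u \<bullet> v) = s\<^sup>2"
    by (simp add: inner_diff_left inner_diff_right inner_commute)
  then have "(u + v) \<bullet> (u + v) = 3 * s\<^sup>2"
    using n(1,2) by (simp add: inner_add_left inner_add_right inner_commute)
  then have "norm (u + v) = sqrt 3 * s"
    using s by (simp add: norm_eq_sqrt_inner real_sqrt_mult)
  moreover have "triangle_centroid x1 x2 x3 - x1 = (1 / 3) *\<^sub>R (u + v)"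
  proof -
    have "x1 = (1 / 3) *\<^sub>R (3 *\<^sub>R x1)"
      by simp
    then have "triangle_centroid x1 x2 x3 - x1 = (1 / 3) *\<^sub>R (x1 + x2 + x3 - 3 *\<^sub>R x1)"
      unfolding triangle_centroid_def by (metis scaleR_diff_right)
    also have "x1 + x2 + x3 - 3 *\<^sub>R x1 = u + v"
      by (simp add: u_def v_def algebra_simps flip: scaleR_2)
         (simp add: scaleR_left_distrib[of 2 1, simplified] scaleR_2)
    finally show ?thesis .
  qed
  ultimately have "dist (triangle_centroid x1 x2 x3) x1 = sqrt 3 * s / 3"
    by (simp add: dist_norm)
  also have "\<dots> = s / sqrt 3"
    by (simp add: field_simps)
  finally show ?thesis .
qed

lemma ratio_equilateral_centroid:
  fixes x1 x2 x3 :: "'a::real_inner"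
  assumes "equilateral_triangle x1 x2 x3" "z = triangle_centroid x1 x2 x3"
  shows "mst_dist x1 x2 x3 / replacement_sum mst_dist x1 x2 x3 z = 1 / sqrt 3"
proof -
  define s where "s = dist x1 x2"
  have s: "dist x1 x2 = s" "dist x2 x3 = s" "dist x3 x1 = s"
    using assms(1) by (simp_all add: equilateral_triangle_def s_def)
  have s0: "0 < s"
    using assms(1) unfolding s_def equilateral_triangle_def zero_less_dist_iff by blast
  have perm: "triangle_centroid x2 x3 x1 = z" "triangle_centroid x3 x1 x2 = z"
    by (simp_all add: assms(2) triangle_centroid_def algebra_simps)
  have p: "dist z x1 = s / sqrt 3" "dist z x2 = s / sqrt 3" "dist z x3 = s / sqrt 3"
    using dist_triangle_centroid[of x1 x2 s x3] dist_triangle_centroid[of x2 x3 s x1]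
      dist_triangle_centroid[of x3 x1 s x2] s perm assms(2) by simp_all
  have "s / sqrt 3 \<le> s"
    using s0 sqrt_3_bounds(1) by (simp add: field_simps)
  then have "replacement_sum mst_dist x1 x2 x3 z = 6 * (s / sqrt 3)"
    using s p unfolding replacement_sum_def mst_dist_eq_min
    by (simp add: dist_commute)
  moreover have "mst_dist x1 x2 x3 = 2 * s"
    using s by (simp add: mst_dist_eq_min dist_commute)
  ultimately have "mst_dist x1 x2 x3 / replacement_sum mst_dist x1 x2 x3 z = 2 * s / (6 * (s / sqrt 3))"
    by simp
  also have "\<dots> = 1 / sqrt 3"
    using s0 by (simp add: field_simps)
  finally show ?thesis .
qed

lemma equilateral_triangle_card:
  assumes "equilateral_triangle x1 x2 x3"
  shows "2 \<le> card {x1, x2, x3}"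
  using assms by (auto simp: equilateral_triangle_def card_insert_if)

lemma equilateral_triangle_of_orthonormal:
  fixes a b :: "'a::real_inner"
  assumes "norm a = 1" "norm b = 1" "a \<bullet> b = 0"
  shows "equilateral_triangle a (- a) (sqrt 3 *\<^sub>R b)"
proof -
  have aa: "a \<bullet> a = 1" and bb: "b \<bullet> b = 1"
    using assms by (simp_all add: dot_square_norm)
  have "dist a (- a) = 2"
    using assms(1) by (simp add: dist_norm flip: scaleR_2)
  moreover have "dist (- a) (sqrt 3 *\<^sub>R b) = 2" "dist (sqrt 3 *\<^sub>R b) a = 2"
    using aa bb assms(3)
    by (simp_all add: dist_norm norm_eq_sqrt_inner inner_diff_left inner_diff_right
        inner_add_left inner_add_right inner_commute)
  moreover have "a \<noteq> - a"
    using \<open>dist a (- a) = 2\<close> by force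
  ultimately show ?thesis
    by (simp add: equilateral_triangle_def)
qed

text \<open>
  A single equilateral triangle shows that the bound \<open>1 / sqrt 3\<close> is attained, so that it is the
  supremum.
\<close>

lemma best_constant3_mst_dist:
  fixes y1 y2 y3 :: "'a::real_inner"
  assumes "equilateral_triangle y1 y2 y3"
  shows "best_constant3 UNIV (mst_dist :: 'a \<Rightarrow> 'a \<Rightarrow> 'a \<Rightarrow> real) = 1 / sqrt 3"
  unfolding best_constant3_def
proof (rule cSup_eq_maximum, goal_cases)
  case 1
  show ?case
    using ratio_equilateral_centroid[OF assms refl] equilateral_triangle_card[OF assms]
    by (smt (verit, best) UNIV_I mem_Collect_eq)
next
  case (2 r)
  then obtain x1 x2 x3 z :: 'a where r: "r = mst_dist x1 x2 x3 / replacement_sum mst_dist x1 x2 x3 z"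
    and c: "2 \<le> card {x1, x2, x3}"
    by blast
  have "\<not> (x1 = x2 \<and> x2 = x3)"
    using c by auto
  then have "0 < mst_dist x1 x2 x3"
    using mst_dist_nonneg mst_dist_eq_0_iff by (metis less_eq_real_def)
  moreover have le: "sqrt 3 * mst_dist x1 x2 x3 \<le> replacement_sum mst_dist x1 x2 x3 z"
    by (rule sqrt3_mst_dist_le_replacement_sum)
  ultimately have "0 < replacement_sum mst_dist x1 x2 x3 z"
    by (smt (verit) real_sqrt_gt_zero mult_pos_pos)
  then show ?case
    using le by (simp add: r field_simps)
qed

theorem proposition4p2:
  assumes "2 \<le> CARD('q::finite)"
  shows "three_distance UNIV (mst_dist :: real^'q \<Rightarrow> real^'q \<Rightarrow> real^'q \<Rightarrow> real) \<and>
    best_constant3 UNIV (mst_dist :: real^'q \<Rightarrow> real^'q \<Rightarrow> real^'q \<Rightarrow> real) = 1 / sqrt 3 \<and>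
    (\<forall>x1 x2 x3 z :: real^'q.
       equilateral_triangle x1 x2 x3 \<and> z = triangle_centroid x1 x2 x3 \<longrightarrow>
       best_constant3_attained_at UNIV mst_dist x1 x2 x3 z)"
proof -
  obtain i j :: 'q where "i \<noteq> j"
    using assms by (metis UNIV_I card_2_iff' card_le_Suc0_iff_eq finite not_less_eq_eq numeral_2_eq_2)
  then have tri: "equilateral_triangle (axis i 1) (- axis i 1) (sqrt 3 *\<^sub>R axis j 1 :: real^'q)"
    by (intro equilateral_triangle_of_orthonormal) (simp_all add: norm_axis_1 inner_axis_axis)
  have const: "best_constant3 UNIV (mst_dist :: real^'q \<Rightarrow> real^'q \<Rightarrow> real^'q \<Rightarrow> real) = 1 / sqrt 3"
    by (rule best_constant3_mst_dist[OF tri])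
  have "\<exists>x y :: real^'q. x \<noteq> y"
    using tri unfolding equilateral_triangle_def by blast
  then show ?thesis
    using const three_distance_mst_dist ratio_equilateral_centroid equilateral_triangle_card
    unfolding best_constant3_attained_at_def by (metis UNIV_I)
qed

end
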